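(* Let $\pi:\tilde X\to X$ be the minimal resolution of a germ of a normal surface singularity $(X,O)$ with $n\ge 2$ exceptional components $E_1,\dots,E_n$, let $A=(a_{i,j})$ be the $n\times n$ symmetric intersection matrix of the exceptional set, and let $A^{(2)}=(a^{(2)}_{i,j})_{1\le i,j\le 2}$ be the last matrix of its Gauss sequence. Then: (1) $a^{(2)}_{1,2}<-a^{(2)}_{1,1}$ if and only if $(NN_{(1,2)})$ is true; (2) $a^{(2)}_{1,2}<-a^{(2)}_{2,2}$ if and only if $(NN_{(2,1)})$ is true; (3) $a^{(2)}_{1,2}<\min\{-a^{(2)}_{1,1},-a^{(2)}_{2,2}\}$ if and only if both $(NN_{(1,2)})$ and $(NN_{(2,1)})$ are true.
   Context: Setting: $(X,O)$ is a germ of a normal surface singularity (over $\mathbb C$), $\pi:\tilde X\to X$ its minimal resolution, $E_1,\dots,E_n$ the irreducible components of the exceptional divisor, $K_{\tilde X}$ the canonical divisor of $\tilde X$. The intersection matrix $A=(a_{i,j})$, $a_{i,j}=E_i\cdot E_j$, is symmetric, negative definite, with integer entries, $a_{i,i}<0$ and $a_{i,j}\ge0$ for $i\neq j$; the dual graph (vertices $E_i$, an edge between $E_i$ and $E_j$, $i\ne j$, iff $a_{i,j}\neq0$) is connected. Minimality gives $K_{\tilde X}\cdot E_i\ge0$ for all $i$. For $i\ne j$, $(NN_{(i,j)})$ is the condition: there exist positive integers $n_1,\dots,n_n$ with $n_i<n_j$ such that $\sum_{l=1}^n n_l\,a_{l,k}\le -2K_{\tilde X}\cdot E_k$ for all $k=1,\dots,n$.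 Gauss sequence of $A$: $a^{(n)}_{i,j}=a_{i,j}$, and for $2\le l\le n-1$ (descending), $$a^{(l)}_{i,j}=a^{(l+1)}_{i,j}-\frac{a^{(l+1)}_{l+1,i}\,a^{(l+1)}_{l+1,j}}{a^{(l+1)}_{l+1,l+1}},\qquad 1\le i,j\le l;$$ $A^{(l)}=(a^{(l)}_{i,j})_{1\le i,j\le l}$. (All divisions are legitimate since the $A^{(l)}$ are negative definite.) *)

theory Defs
  imports Complex_Main
begin

text \<open>
  The numerical data of the minimal resolution of a normal surface singularity with exceptional
  components \<open>E\<^sub>1, \<dots>, E\<^sub>n\<close>:
  \<open>A i j\<close> is the intersection number \<open>E\<^sub>i \<cdot> E\<^sub>j\<close>, and \<open>KE i\<close> is \<open>K \<cdot> E\<^sub>i\<close> for the canonical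
  divisor \<open>K\<close> of the resolution. Indices run over \<open>{1..n}\<close>; values of \<open>A\<close> and \<open>KE\<close> outside this
  range are irrelevant. The axioms are the standard facts about such data; the last one is
  the minimality of the resolution.
\<close>

definition negative_definite :: "nat \<Rightarrow> (nat \<Rightarrow> nat \<Rightarrow> int) \<Rightarrow> bool" where
  "negative_definite n A \<longleftrightarrow>
     (\<forall>x :: nat \<Rightarrow> real. (\<exists>i\<in>{1..n}. x i \<noteq> 0) \<longrightarrow>
        (\<Sum>i=1..n. \<Sum>j=1..n. x i * of_int (A i j) * x j) < 0)"

definition dual_graph_edges :: "nat \<Rightarrow> (nat \<Rightarrow> nat \<Rightarrow> int) \<Rightarrow> (nat \<times> nat) set" where
  "dual_graph_edges n A = {(i, j). i \<in> {1..n} \<and> j \<in> {1..n} \<and> i \<noteq> j \<and> A i j \<noteq> 0}"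

locale minimal_resolution_data =
  fixes n :: nat and A :: "nat \<Rightarrow> nat \<Rightarrow> int" and KE :: "nat \<Rightarrow> int"
  assumes symmetric: "\<And>i j. \<lbrakk>i \<in> {1..n}; j \<in> {1..n}\<rbrakk> \<Longrightarrow> A i j = A j i"
    and neg_def: "negative_definite n A"
    and diag_neg: "\<And>i. i \<in> {1..n} \<Longrightarrow> A i i < 0"
    and off_diag_nonneg: "\<And>i j. \<lbrakk>i \<in> {1..n}; j \<in> {1..n}; i \<noteq> j\<rbrakk> \<Longrightarrow> 0 \<le> A i j"
    and graph_connected:
      "\<And>i j. \<lbrakk>i \<in> {1..n}; j \<in> {1..n}\<rbrakk> \<Longrightarrow> (i, j) \<in> (dual_graph_edges n A)\<^sup>*"
    and minimality: "\<And>i. i \<in> {1..n} \<Longrightarrow> 0 \<le> KE i"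

definition NN :: "nat \<Rightarrow> (nat \<Rightarrow> nat \<Rightarrow> int) \<Rightarrow> (nat \<Rightarrow> int) \<Rightarrow> nat \<Rightarrow> nat \<Rightarrow> bool" where
  "NN n A KE i j \<longleftrightarrow>
     (\<exists>m :: nat \<Rightarrow> int. (\<forall>l\<in>{1..n}. 0 < m l) \<and> m i < m j \<and>
        (\<forall>k\<in>{1..n}. (\<Sum>l=1..n. m l * A l k) \<le> - 2 * KE k))"

text \<open>
  \<open>gauss_seq n A l i j\<close> is the entry \<open>a\<^sup>(\<^sup>l\<^sup>)\<close> at \<open>(i, j)\<close> of the Gauss sequence of the
  \<open>n \<times> n\<close> matrix \<open>A\<close>. It is meaningful for \<open>2 \<le> l \<le> n\<close> and \<open>1 \<le> i, j \<le> l\<close>, and for these arguments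
  the recursion only refers to meaningful entries.
\<close>

function gauss_seq :: "nat \<Rightarrow> (nat \<Rightarrow> nat \<Rightarrow> int) \<Rightarrow> nat \<Rightarrow> nat \<Rightarrow> nat \<Rightarrow> real" where
  "gauss_seq n A l i j =
     (if n \<le> l then of_int (A i j)
      else gauss_seq n A (l + 1) i j
           - gauss_seq n A (l + 1) (l + 1) i * gauss_seq n A (l + 1) (l + 1) j
             / gauss_seq n A (l + 1) (l + 1) (l + 1))"
  by pat_completeness auto
termination by (relation "measure (\<lambda>(n, A, l, i, j). n - l)") auto

declare gauss_seq.simps [simp del]

end

theory Submission
  imports Defs
begin

text \<open>
  One step of the Gauss sequence is a Schur complement: it adds a multiple of the last row to each
  other row, and the multiplier is nonnegative. Hence it preserves symmetry, negative definiteness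
  and the sign of the off-diagonal entries, and it maps solutions of \<open>B x \<le> 0\<close> to solutions.
  Conversely, a solution of the strict system \<open>B x < 0\<close> lifts through the step: choose the new
  coordinate slightly larger than the value that annihilates the last row. So everything reduces to
  \<open>2 \<times> 2\<close> matrices. A real solution of the strict system for \<open>A\<close> becomes an integral solution
  below any given bound, such as \<open>-2 K \<cdot> E\<^sub>k\<close>, after scaling by a large \<open>N\<close> and rounding.
\<close>

section \<open>Stieltjes matrices up to sign, and their Schur complements\<close>

text \<open>On \<open>{1..m}\<close>, \<open>- B\<close> is a Stieltjes matrix. The quadratic form
  is grouped by rows, so that facts about row sums can be substituted into it.\<close>

definition neg_stieltjes :: "nat \<Rightarrow> (nat \<Rightarrow> nat \<Rightarrow> real) \<Rightarrow> bool" where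
  "neg_stieltjes m B \<longleftrightarrow>
     (\<forall>i\<in>{1..m}. \<forall>j\<in>{1..m}. B i j = B j i) \<and>
     (\<forall>i\<in>{1..m}. \<forall>j\<in>{1..m}. i \<noteq> j \<longrightarrow> 0 \<le> B i j) \<and>
     (\<forall>x. (\<exists>i\<in>{1..m}. x i \<noteq> 0) \<longrightarrow> (\<Sum>i=1..m. x i * (\<Sum>j=1..m. B i j * x j)) < 0)"

text \<open>The Schur complement of the last diagonal entry. Both factors come from the last row, as
  in the Gauss recursion, so that \<open>gauss_seq_step\<close> is a mere unfolding.\<close>

definition schur :: "nat \<Rightarrow> (nat \<Rightarrow> nat \<Rightarrow> real) \<Rightarrow> nat \<Rightarrow> nat \<Rightarrow> real" where
  "schur m B i j = B i j - B (Suc m) i * B (Suc m) j / B (Suc m) (Suc m)"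

lemma neg_stieltjes_sym:
  "neg_stieltjes m B \<Longrightarrow> i \<in> {1..m} \<Longrightarrow> j \<in> {1..m} \<Longrightarrow> B i j = B j i"
  unfolding neg_stieltjes_def by blast

lemma neg_stieltjes_off_diag:
  "neg_stieltjes m B \<Longrightarrow> i \<in> {1..m} \<Longrightarrow> j \<in> {1..m} \<Longrightarrow> i \<noteq> j \<Longrightarrow> 0 \<le> B i j"
  unfolding neg_stieltjes_def by blast

lemma neg_stieltjes_form:
  "neg_stieltjes m B \<Longrightarrow> i \<in> {1..m} \<Longrightarrow> x i \<noteq> 0 \<Longrightarrow>
     (\<Sum>i=1..m. x i * (\<Sum>j=1..m. B i j * x j)) < 0"
  unfolding neg_stieltjes_def by blast

lemma neg_stieltjes_diag:
  assumes "neg_stieltjes m B" "i \<in> {1..m}"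
  shows "B i i < 0"
proof -
  define e :: "nat \<Rightarrow> real" where "e = (\<lambda>k. if k = i then 1 else 0)"
  have "(\<Sum>k=1..m. e k * (\<Sum>j=1..m. B k j * e j)) = B i i"
    using assms(2) by (simp add: e_def if_distrib[of "(*) _"] if_distrib[of "\<lambda>c. c * _"]
        sum.delta cong: if_cong)
  then show ?thesis
    using neg_stieltjes_form[OF assms, of e] by (simp add: e_def)
qed

text \<open>Row elimination: subtracting the multiple of the last row that clears the last entry of
  row \<open>i\<close> leaves row \<open>i\<close> of the Schur complement.\<close>

lemma row_sum_schur:
  assumes "B i (Suc m) = B (Suc m) i" "B (Suc m) (Suc m) \<noteq> 0"
  shows "(\<Sum>j=1..Suc m. B i j * x j) = (\<Sum>j=1..m. schur m B i j * x j)
           + B (Suc m) i / B (Suc m) (Suc m) * (\<Sum>j=1..Suc m. B (Suc m) j * x j)"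
proof -
  have "(\<Sum>j=1..m. schur m B i j * x j) = (\<Sum>j=1..m. B i j * x j)
      - B (Suc m) i / B (Suc m) (Suc m) * (\<Sum>j=1..m. B (Suc m) j * x j)"
    by (simp add: schur_def sum_distrib_left sum_subtractf[symmetric] algebra_simps)
  then show ?thesis using assms by (simp add: algebra_simps)
qed

text \<open>For definiteness, the form of the complement at \<open>x\<close> equals the form of
  \<open>B\<close> at the extension of \<open>x\<close> whose last coordinate makes the last row sum
  vanish.\<close>

lemma neg_stieltjes_schur:
  assumes B: "neg_stieltjes (Suc m) B"
  shows "neg_stieltjes m (schur m B)"
proof -
  let ?d = "B (Suc m) (Suc m)"
  have d: "?d < 0" using neg_stieltjes_diag[OF B] by simp
  have form: "(\<Sum>i=1..m. x i * (\<Sum>j=1..m. schur m B i j * x j)) < 0"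
    if i0: "i0 \<in> {1..m}" "x i0 \<noteq> 0" for x i0
  proof -
    define y where "y = x(Suc m := - (\<Sum>j=1..m. B (Suc m) j * x j) / ?d)"
    have y: "y i = x i" if "i \<in> {1..m}" for i using that by (simp add: y_def)
    have last: "(\<Sum>j=1..Suc m. B (Suc m) j * y j) = 0"
    proof -
      have "(\<Sum>j=1..m. B (Suc m) j * y j) = (\<Sum>j=1..m. B (Suc m) j * x j)"
        using y by (intro sum.cong) auto
      then show ?thesis using d by (simp add: y_def)
    qed
    have "(\<Sum>i=1..Suc m. y i * (\<Sum>j=1..Suc m. B i j * y j))
        = (\<Sum>i=1..m. y i * (\<Sum>j=1..Suc m. B i j * y j))"
      using last by simp
    also have "\<dots> = (\<Sum>i=1..m. x i * (\<Sum>j=1..m. schur m B i j * x j))"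
    proof (intro sum.cong refl)
      fix i assume i: "i \<in> {1..m}"
      then have "B i (Suc m) = B (Suc m) i" using neg_stieltjes_sym[OF B] by simp
      then have "(\<Sum>j=1..Suc m. B i j * y j) = (\<Sum>j=1..m. schur m B i j * y j)"
        using row_sum_schur[of B i m y] last d by simp
      also have "\<dots> = (\<Sum>j=1..m. schur m B i j * x j)"
        using y by (intro sum.cong) auto
      finally show "y i * (\<Sum>j=1..Suc m. B i j * y j) = x i * (\<Sum>j=1..m. schur m B i j * x j)"
        using y[OF i] by simp
    qed
    finally show ?thesis
      using neg_stieltjes_form[OF B, of i0 y] i0 y[of i0] by simp
  qed
  have "0 \<le> schur m B i j" if "i \<in> {1..m}" "j \<in> {1..m}" "i \<noteq> j" for i j
  proof -
    have "0 \<le> B i j" "0 \<le> B (Suc m) i" "0 \<le> B (Suc m) j"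
      using neg_stieltjes_off_diag[OF B] that by auto
    then have "B (Suc m) i * B (Suc m) j / ?d \<le> 0"
      using d by (intro divide_nonneg_neg mult_nonneg_nonneg)
    then show ?thesis using \<open>0 \<le> B i j\<close> by (simp add: schur_def)
  qed
  moreover have "schur m B i j = schur m B j i" if "i \<in> {1..m}" "j \<in> {1..m}" for i j
    using neg_stieltjes_sym[OF B, of i j] that by (simp add: schur_def)
  ultimately show ?thesis using form unfolding neg_stieltjes_def by blast
qed

text \<open>In \<open>row_sum_schur\<close> the coefficient of the last row sum and that sum itself
  are both nonpositive; their product is nonnegative, and removing it only lowers the row
  sum.\<close>

lemma schur_row_sum_nonpos:
  assumes B: "neg_stieltjes (Suc m) B"
    and rows: "\<And>k. k \<in> {1..Suc m} \<Longrightarrow> (\<Sum>j=1..Suc m. B k j * x j) \<le> 0"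
    and k: "k \<in> {1..m}"
  shows "(\<Sum>j=1..m. schur m B k j * x j) \<le> 0"
proof -
  let ?d = "B (Suc m) (Suc m)"
  have d: "?d < 0" using neg_stieltjes_diag[OF B] by simp
  have "0 \<le> B (Suc m) k" "B k (Suc m) = B (Suc m) k"
    using neg_stieltjes_off_diag[OF B] neg_stieltjes_sym[OF B] k by auto
  moreover have "0 \<le> B (Suc m) k / ?d * (\<Sum>j=1..Suc m. B (Suc m) j * x j)"
    using rows[of "Suc m"] d \<open>0 \<le> B (Suc m) k\<close>
    by (intro mult_nonpos_nonpos divide_nonneg_neg) auto
  ultimately show ?thesis
    using row_sum_schur[of B k m x] rows[of k] k d by simp
qed

lemma lift_strict_solution:
  assumes B: "neg_stieltjes (Suc m) B"
    and pos: "\<And>i. i \<in> {1..m} \<Longrightarrow> 0 < x i"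
    and rows: "\<And>k. k \<in> {1..m} \<Longrightarrow> (\<Sum>j=1..m. schur m B k j * x j) < 0"
  obtains c where "0 < c"
    and "\<And>k. k \<in> {1..Suc m} \<Longrightarrow> (\<Sum>j=1..Suc m. B k j * (x(Suc m := c)) j) < 0"
proof -
  let ?d = "B (Suc m) (Suc m)"
  \<comment> \<open>The last coordinate \<open>s\<close> makes the last row sum zero;
    \<open>s + e\<close> makes it \<open>?d * e\<close>, which is negative for
    \<open>e > 0\<close>.\<close>
  define s where "s = - (\<Sum>j=1..m. B (Suc m) j * x j) / ?d"
  have d: "?d < 0" using neg_stieltjes_diag[OF B] by simp
  have "0 \<le> (\<Sum>j=1..m. B (Suc m) j * x j)"
    using neg_stieltjes_off_diag[OF B] pos
    by (intro sum_nonneg mult_nonneg_nonneg) (auto intro: less_imp_le)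
  then have s: "0 \<le> s" using d by (simp add: s_def divide_nonneg_neg)
  \<comment> \<open>With last coordinate \<open>s + e\<close>, row \<open>k\<close> of
    \<open>B\<close> has this sum. Finitely many strict inequalities survive a small
    perturbation.\<close>
  have "\<forall>\<^sub>F e in at_right 0. \<forall>k\<in>{1..m}. (\<Sum>j=1..m. schur m B k j * x j) + B (Suc m) k * e < 0"
  proof (intro eventually_ball_finite ballI)
    fix k assume k: "k \<in> {1..m}"
    have "((\<lambda>e. (\<Sum>j=1..m. schur m B k j * x j) + B (Suc m) k * e) \<longlongrightarrow>
        (\<Sum>j=1..m. schur m B k j * x j) + B (Suc m) k * 0) (at_right 0)"
      by (intro tendsto_intros)
    then show "\<forall>\<^sub>F e in at_right 0. (\<Sum>j=1..m. schur m B k j * x j) + B (Suc m) k * e < 0"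
      using rows[OF k] by (intro order_tendstoD(2)) auto
  qed simp
  moreover have "\<forall>\<^sub>F e::real in at_right 0. 0 < e" by (rule eventually_at_right_less)
  ultimately have "\<forall>\<^sub>F e in at_right 0. 0 < e \<and>
      (\<forall>k\<in>{1..m}. (\<Sum>j=1..m. schur m B k j * x j) + B (Suc m) k * e < 0)"
    by eventually_elim blast
  from eventually_happens'[OF trivial_limit_at_right_real this]
  obtain e where e: "0 < e"
    "\<And>k. k \<in> {1..m} \<Longrightarrow> (\<Sum>j=1..m. schur m B k j * x j) + B (Suc m) k * e < 0"
    by blast
  define y where "y = x(Suc m := s + e)"
  have eq: "(\<Sum>j=1..m. f j * y j) = (\<Sum>j=1..m. f j * x j)" for f
    by (intro sum.cong) (auto simp: y_def)
  have last: "(\<Sum>j=1..Suc m. B (Suc m) j * y j) = ?d * e"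
    using eq[of "B (Suc m)"] d by (simp add: y_def s_def field_simps)
  have "(\<Sum>j=1..Suc m. B k j * y j) < 0" if "k \<in> {1..Suc m}" for k
  proof (cases "k = Suc m")
    case True
    then show ?thesis using last d e(1) by (simp add: mult_neg_pos)
  next
    case False
    then have k: "k \<in> {1..m}" using that by auto
    then have "B k (Suc m) = B (Suc m) k" using neg_stieltjes_sym[OF B] by simp
    then show ?thesis using row_sum_schur[of B k m y] last d e(2)[OF k] eq by simp
  qed
  then show ?thesis using that[of "s + e"] s e(1) by (simp add: y_def)
qed

section \<open>The Gauss sequence as an iterated Schur complement\<close>

lemma gauss_seq_top: "gauss_seq n A n = (\<lambda>i j. of_int (A i j))"
  by (intro ext) (simp add: gauss_seq.simps[of n A n])

lemma gauss_seq_step: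
  "l < n \<Longrightarrow> gauss_seq n A l = schur l (gauss_seq n A (Suc l))"
  by (intro ext) (simp add: gauss_seq.simps[of n A l] schur_def)

context minimal_resolution_data
begin

lemma neg_stieltjes_gauss_seq:
  assumes "l \<le> n"
  shows "neg_stieltjes l (gauss_seq n A l)"
  using assms
proof (induction l rule: inc_induct)
  case base
  have "(\<Sum>i=1..n. x i * (\<Sum>j=1..n. of_int (A i j) * x j)) < 0"
    if "\<exists>i\<in>{1..n}. x i \<noteq> 0" for x :: "nat \<Rightarrow> real"
    using neg_def that unfolding negative_definite_def by (simp add: sum_distrib_left mult.assoc)
  then show ?case
    using symmetric off_diag_nonneg unfolding neg_stieltjes_def gauss_seq_top by auto
next
  case (step l)
  then show ?case using neg_stieltjes_schur gauss_seq_step by simp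
qed

text \<open>The descent only truncates \<open>x\<close>, so a comparison of its first two
  coordinates carries over to the 2x2 matrix.\<close>

lemma gauss_seq_row_sum_nonpos:
  assumes "l \<le> n"
    and rows: "\<And>k. k \<in> {1..n} \<Longrightarrow> (\<Sum>j=1..n. of_int (A k j) * x j) \<le> 0"
  shows "\<forall>k\<in>{1..l}. (\<Sum>j=1..l. gauss_seq n A l k j * x j) \<le> 0"
  using assms(1)
proof (induction l rule: inc_induct)
  case base
  then show ?case using rows by (simp add: gauss_seq_top)
next
  case (step l)
  then show ?case
    using schur_row_sum_nonpos[OF neg_stieltjes_gauss_seq[of "Suc l"]] gauss_seq_step by simp
qed

text \<open>Each lift appends one coordinate. Keeping the first \<open>l\<close> preserves the
  comparison made at the 2x2 level.\<close>

lemma lift_strict_solution_gauss_seq: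
  assumes "l \<le> l'" "l' \<le> n"
    and "\<And>i. i \<in> {1..l} \<Longrightarrow> 0 < x i"
    and "\<And>k. k \<in> {1..l} \<Longrightarrow> (\<Sum>j=1..l. gauss_seq n A l k j * x j) < 0"
  shows "\<exists>y. (\<forall>i\<in>{1..l}. y i = x i) \<and> (\<forall>i\<in>{1..l'}. 0 < y i) \<and>
           (\<forall>k\<in>{1..l'}. (\<Sum>j=1..l'. gauss_seq n A l' k j * y j) < 0)"
  using assms(1,2)
proof (induction l' rule: dec_induct)
  case base
  then show ?case using assms(3,4) by blast
next
  case (step m)
  then obtain y where y: "\<forall>i\<in>{1..l}. y i = x i" "\<forall>i\<in>{1..m}. 0 < y i"
    "\<forall>k\<in>{1..m}. (\<Sum>j=1..m. gauss_seq n A m k j * y j) < 0"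
    by auto
  have "gauss_seq n A m = schur m (gauss_seq n A (Suc m))"
    using gauss_seq_step step.prems by simp
  then obtain c where c: "0 < c" "\<And>k. k \<in> {1..Suc m} \<Longrightarrow>
      (\<Sum>j=1..Suc m. gauss_seq n A (Suc m) k j * (y(Suc m := c)) j) < 0"
    using lift_strict_solution[OF neg_stieltjes_gauss_seq[OF step.prems], of y] y(2,3) by auto
  show ?case
    using y(1,2) c step.hyps by (intro exI[of _ "y(Suc m := c)"]) (auto simp del: sum.cl_ivl_Suc)
qed

end

section \<open>The 2x2 case\<close>

text \<open>Since \<open>B p q < - B p p\<close>, weighting the right-hand side towards row
  \<open>q\<close> raises \<open>x q\<close> faster than \<open>x p\<close>. Taking
  \<open>{p, q} = {1, 2}\<close> serves both orders.\<close>

lemma strict_solution_2x2: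
  fixes B :: "nat \<Rightarrow> nat \<Rightarrow> real"
  assumes B: "neg_stieltjes 2 B" and pq: "{p, q} = {1, 2}" and less: "B p q < - B p p"
  obtains x where "\<And>i. i \<in> {1..2} \<Longrightarrow> 0 < x i" "x p < x q"
    "\<And>k. k \<in> {1..2} \<Longrightarrow> (\<Sum>j=1..2. B k j * x j) < 0"
proof -
  have "p \<noteq> q" using pq by (auto simp: doubleton_eq_iff)
  have ivl: "{1..2} = {p, q}" unfolding pq by auto
  have mem: "p \<in> {1..2}" "q \<in> {1..2}" unfolding ivl by auto
  have sum2: "(\<Sum>j=1..2. f j) = f p + f q" for f :: "nat \<Rightarrow> real"
    using \<open>p \<noteq> q\<close> by (simp only: ivl) simp
  define P Q r where "P = - B p p" and "Q = - B q q" and "r = B p q"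
  have pos: "0 < P" "0 < Q" "0 \<le> r" and qp: "B q p = r"
    unfolding P_def Q_def r_def
    using neg_stieltjes_diag[OF B mem(1)] neg_stieltjes_diag[OF B mem(2)]
      neg_stieltjes_off_diag[OF B mem \<open>p \<noteq> q\<close>] neg_stieltjes_sym[OF B mem] by simp_all
  \<comment> \<open>Row \<open>p\<close> annihilates \<open>v\<close>, so the form at
    \<open>v\<close> is \<open>P\<close> times the sum of row \<open>q\<close>, which is minus the
    determinant.\<close>
  define v where "v = (\<lambda>i. if i = p then r else P)"
  have "(\<Sum>i=1..2. v i * (\<Sum>j=1..2. B i j * v j)) < 0"
    using neg_stieltjes_form[OF B mem(2), of v] \<open>p \<noteq> q\<close> pos by (simp add: v_def)
  then have "P * (r * r - P * Q) < 0"
    unfolding sum2 using \<open>p \<noteq> q\<close> qp by (simp add: v_def P_def Q_def r_def algebra_simps)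
  then have det: "r * r < P * Q" using pos by (simp add: mult_less_0_iff)
  define c where "c = (Q + 1) / (P - r)"
  have Pr: "0 < P - r" using less by (simp add: P_def r_def)
  then have c: "0 < c" "c * (P - r) = Q + 1" using pos by (simp_all add: c_def)
  \<comment> \<open>Up to a positive factor, Cramer's solution of \<open>B x = (-1, -c)\<close> (order \<open>p, q\<close>), where \<open>c\<close> is
      such that \<open>x q - x p = r + 1\<close>.\<close>
  define x where "x = (\<lambda>i. if i = p then Q + r * c else r + P * c)"
  have x: "x p = Q + r * c" "x q = r + P * c" using \<open>p \<noteq> q\<close> by (auto simp: x_def)
  have "0 < x p" "0 < x q" using pos c by (auto simp: x intro: add_pos_nonneg add_nonneg_pos)
  then have "\<forall>i\<in>{1..2}. 0 < x i" unfolding ivl by simp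
  moreover have "x p < x q" using c(2) pos by (simp add: x algebra_simps)
  moreover have "\<forall>k\<in>{1..2}. (\<Sum>j=1..2. B k j * x j) < 0"
  proof -
    have "B p p * x p + B p q * x q = r * r - P * Q"
      by (simp add: x P_def r_def algebra_simps)
    moreover have "B q p * x p + B q q * x q = c * (r * r - P * Q)"
      by (simp add: x Q_def qp algebra_simps)
    ultimately show ?thesis unfolding sum2 unfolding ivl using det c(1) by (simp add: mult_pos_neg)
  qed
  ultimately show ?thesis using that[of x] by blast
qed

section \<open>From real to integral solutions\<close>

text \<open>Rounding changes the sum by at most \<open>?c\<close>, independently of
  \<open>N\<close>, while \<open>N * ?s\<close> falls below every bound.\<close>

lemma eventually_row_sum_floor_le:
  fixes a x :: "nat \<Rightarrow> real"
  assumes "(\<Sum>j=1..n. a j * x j) < 0"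
  shows "\<forall>\<^sub>F N in at_top. (\<Sum>j=1..n. a j * of_int \<lfloor>N * x j\<rfloor>) \<le> b"
proof -
  let ?s = "\<Sum>j=1..n. a j * x j" and ?c = "\<Sum>j=1..n. \<bar>a j\<bar>"
  have "(\<Sum>j=1..n. a j * of_int \<lfloor>N * x j\<rfloor>) \<le> N * ?s + ?c" for N
  proof -
    have "a j * of_int \<lfloor>N * x j\<rfloor> \<le> N * (a j * x j) + \<bar>a j\<bar>" for j
    proof -
      have "\<bar>of_int \<lfloor>N * x j\<rfloor> - N * x j\<bar> \<le> 1" by linarith
      then have "\<bar>a j\<bar> * \<bar>of_int \<lfloor>N * x j\<rfloor> - N * x j\<bar> \<le> \<bar>a j\<bar> * 1"
        by (intro mult_left_mono) auto
      then have "a j * (of_int \<lfloor>N * x j\<rfloor> - N * x j) \<le> \<bar>a j\<bar>"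
        unfolding abs_mult[symmetric] by linarith
      then show ?thesis by (simp add: algebra_simps)
    qed
    then show ?thesis
      unfolding sum_distrib_left sum.distrib[symmetric] by (intro sum_mono)
  qed
  moreover have "\<forall>\<^sub>F N in at_top. (b - ?c) / ?s \<le> N" by (rule eventually_ge_at_top)
  ultimately show ?thesis
  proof (elim eventually_mono)
    fix N assume "(b - ?c) / ?s \<le> N"
      and le: "\<And>N. (\<Sum>j=1..n. a j * of_int \<lfloor>N * x j\<rfloor>) \<le> N * ?s + ?c"
    then have "N * ?s + ?c \<le> b" using assms by (simp add: neg_divide_le_eq)
    then show "(\<Sum>j=1..n. a j * of_int \<lfloor>N * x j\<rfloor>) \<le> b" using le[of N] by linarith
  qed
qed

context minimal_resolution_data
begin

lemma NN_if_strict_solution: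
  fixes x :: "nat \<Rightarrow> real"
  assumes pos: "\<And>i. i \<in> {1..n} \<Longrightarrow> 0 < x i" and less: "x p < x q"
    and rows: "\<And>k. k \<in> {1..n} \<Longrightarrow> (\<Sum>j=1..n. of_int (A k j) * x j) < 0"
  shows "NN n A KE p q"
proof -
  \<comment> \<open>Three demands on \<open>N\<close>: \<open>N * x i\<close> reaches 1, so its
    floor is positive; the gap \<open>N * (x q - x p)\<close> reaches 1, so the floors stay strictly
    ordered; the row sums meet their bounds.\<close>
  have "\<forall>\<^sub>F N in at_top. \<forall>i\<in>{1..n}. 1 / x i \<le> N"
    by (intro eventually_ball_finite ballI eventually_ge_at_top) simp
  moreover have "\<forall>\<^sub>F N in at_top. 1 / (x q - x p) \<le> N" by (rule eventually_ge_at_top)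
  moreover have "\<forall>\<^sub>F N in at_top. \<forall>k\<in>{1..n}.
      (\<Sum>j=1..n. of_int (A k j) * of_int \<lfloor>N * x j\<rfloor>) \<le> (of_int (- 2 * KE k) :: real)"
    using rows by (intro eventually_ball_finite ballI eventually_row_sum_floor_le) auto
  ultimately have "\<forall>\<^sub>F N in at_top. (\<forall>i\<in>{1..n}. 1 / x i \<le> N) \<and> 1 / (x q - x p) \<le> N \<and>
      (\<forall>k\<in>{1..n}. (\<Sum>j=1..n. of_int (A k j) * of_int \<lfloor>N * x j\<rfloor>) \<le> (of_int (- 2 * KE k) :: real))"
    by eventually_elim blast
  from eventually_happens'[OF trivial_limit_at_top_linorder this]
  obtain N where N: "\<And>i. i \<in> {1..n} \<Longrightarrow> 1 / x i \<le> N" "1 / (x q - x p) \<le> N"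
    "\<And>k. k \<in> {1..n} \<Longrightarrow>
       (\<Sum>j=1..n. of_int (A k j) * of_int \<lfloor>N * x j\<rfloor>) \<le> (of_int (- 2 * KE k) :: real)"
    by blast
  define m where "m = (\<lambda>j. \<lfloor>N * x j\<rfloor>)"
  have "0 < m i" if "i \<in> {1..n}" for i
    using N(1)[OF that] pos[OF that] by (simp add: m_def pos_divide_le_eq)
  moreover have "m p < m q"
  proof -
    have "1 \<le> N * (x q - x p)" using N(2) less by (simp add: pos_divide_le_eq)
    then have "N * x p + 1 \<le> N * x q" by (simp add: algebra_simps)
    then show ?thesis unfolding m_def by linarith
  qed
  moreover have "(\<Sum>l=1..n. m l * A l k) \<le> - 2 * KE k" if k: "k \<in> {1..n}" for k
  proof -
    have "of_int (\<Sum>j=1..n. A k j * m j) \<le> (of_int (- 2 * KE k) :: real)"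
      using N(3)[OF k] by (simp add: m_def)
    then have "(\<Sum>j=1..n. A k j * m j) \<le> - 2 * KE k" by (simp only: of_int_le_iff)
    moreover have "(\<Sum>l=1..n. m l * A l k) = (\<Sum>j=1..n. A k j * m j)"
      using symmetric k by (intro sum.cong) auto
    ultimately show ?thesis by simp
  qed
  ultimately show ?thesis unfolding NN_def by blast
qed

section \<open>The equivalence for either order of the first two components\<close>

lemma NN_iff_gauss_seq:
  assumes n: "2 \<le> n" and pq: "{p, q} = {1, 2}"
  shows "gauss_seq n A 2 p q < - gauss_seq n A 2 p p \<longleftrightarrow> NN n A KE p q"
proof
  have ivl: "{1..2} = {p, q}" unfolding pq by auto
  assume "gauss_seq n A 2 p q < - gauss_seq n A 2 p p"
  then obtain x where x: "\<And>i. i \<in> {1..2} \<Longrightarrow> 0 < x i" "x p < x q"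
    "\<And>k. k \<in> {1..2} \<Longrightarrow> (\<Sum>j=1..2. gauss_seq n A 2 k j * x j) < 0"
    using strict_solution_2x2[OF neg_stieltjes_gauss_seq[OF n] pq] by blast
  obtain y where y: "\<forall>i\<in>{1..2}. y i = x i" "\<forall>i\<in>{1..n}. 0 < y i"
    "\<forall>k\<in>{1..n}. (\<Sum>j=1..n. gauss_seq n A n k j * y j) < 0"
    using lift_strict_solution_gauss_seq[of 2 n x] n x by blast
  have "y p < y q" using y(1) x(2) ivl by auto
  then show "NN n A KE p q" using y(2,3)
    by (intro NN_if_strict_solution[of y]) (auto simp: gauss_seq_top)
next
  let ?G = "gauss_seq n A 2"
  have ivl: "{1..2} = {p, q}" unfolding pq by auto
  assume "NN n A KE p q"
  then obtain m where m: "\<And>l. l \<in> {1..n} \<Longrightarrow> 0 < m l" "m p < m q"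
    "\<And>k. k \<in> {1..n} \<Longrightarrow> (\<Sum>l=1..n. m l * A l k) \<le> - 2 * KE k"
    unfolding NN_def by blast
  define x :: "nat \<Rightarrow> real" where "x = (\<lambda>l. of_int (m l))"
  have "(\<Sum>j=1..n. of_int (A k j) * x j) \<le> 0" if k: "k \<in> {1..n}" for k
  proof -
    have "(\<Sum>j=1..n. A k j * m j) = (\<Sum>l=1..n. m l * A l k)"
      using symmetric k by (intro sum.cong) auto
    \<comment> \<open>Minimality enters here: the bound \<open>- 2 * KE k\<close> is at most
      0.\<close>
    also have "\<dots> \<le> 0" using m(3)[OF k] minimality[OF k] by linarith
    finally have "of_int (\<Sum>j=1..n. A k j * m j) \<le> (0 :: real)" by (simp only: of_int_le_0_iff)
    then show ?thesis by (simp add: x_def)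
  qed
  then have "\<forall>k\<in>{1..2}. (\<Sum>j=1..2. ?G k j * x j) \<le> 0"
    using gauss_seq_row_sum_nonpos[of 2 x] n by blast
  then have "(\<Sum>j\<in>{p, q}. ?G p j * x j) \<le> 0" by (simp only: ivl) simp
  moreover have "p \<noteq> q" using m(2) by auto
  ultimately have row: "?G p p * x p + ?G p q * x q \<le> 0" by simp
  have "p \<in> {1..2}" "q \<in> {1..2}" unfolding ivl by auto
  then have "?G p p < 0" using neg_stieltjes_diag[OF neg_stieltjes_gauss_seq[OF n]] by blast
  \<comment> \<open>As \<open>?G p p\<close> is negative, replacing \<open>x p\<close> by the larger
    \<open>x q\<close> makes the row inequality strict and lets \<open>x q\<close> be factored
    out.\<close>
  then have "?G p p * x q < ?G p p * x p" using m(2) by (simp add: x_def)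
  then have "x q * (?G p p + ?G p q) < 0" using row by (simp add: algebra_simps)
  moreover have "0 < x q" using m(1)[of q] \<open>q \<in> {1..2}\<close> n by (simp add: x_def)
  ultimately show "?G p q < - ?G p p" by (simp add: mult_less_0_iff)
qed

end

theorem proposition3:
  fixes n :: nat and A :: "nat \<Rightarrow> nat \<Rightarrow> int" and KE :: "nat \<Rightarrow> int"
  assumes "n \<ge> 2"
    and "minimal_resolution_data n A KE"
  shows "(gauss_seq n A 2 1 2 < - gauss_seq n A 2 1 1 \<longleftrightarrow> NN n A KE 1 2) \<and>
    (gauss_seq n A 2 1 2 < - gauss_seq n A 2 2 2 \<longleftrightarrow> NN n A KE 2 1) \<and>
    (gauss_seq n A 2 1 2 < min (- gauss_seq n A 2 1 1) (- gauss_seq n A 2 2 2)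
           \<longleftrightarrow> NN n A KE 1 2 \<and> NN n A KE 2 1)"
proof -
  interpret minimal_resolution_data n A KE by fact
  \<comment> \<open>The equivalence for \<open>(2, 1)\<close> concerns the entry at
    \<open>(2, 1)\<close>; symmetry turns it into the entry at \<open>(1, 2)\<close>.\<close>
  have "gauss_seq n A 2 1 2 = gauss_seq n A 2 2 1"
    using neg_stieltjes_sym[OF neg_stieltjes_gauss_seq[OF assms(1)]] by simp
  then show ?thesis
    using NN_iff_gauss_seq[OF assms(1), of 1 2] NN_iff_gauss_seq[OF assms(1), of 2 1]
    by (simp add: insert_commute)
qed

end
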